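(* Let $K$ be a noetherian commutative ring with unity, let $c\ge1$ and $d\ge 0$ be integers, and let $\mathbf{F}^{\mathrm{OI},d}$ be the free $\mathrm{OI}$-module over the $\mathrm{OI}$-algebra $\mathbf{P}\cong(\mathbf{X}^{\mathrm{OI},1})^{\otimes c}$. Fix any monomial order $>$ on $\mathbf{F}^{\mathrm{OI},d}$. Then every $\mathrm{OI}$-submodule of $\mathbf{F}^{\mathrm{OI},d}$ has a finite Gröbner basis with respect to $>$.
   Context: $[n]=\{1,\dots,n\}$, $[0]=\emptyset$. $\mathrm{OI}$ is the category of totally ordered finite sets and order-preserving injective maps. $\mathbf{P}$ is the functor from $\mathrm{OI}$ to commutative $K$-algebras with $\mathbf{P}_m=\mathbf{P}([m])=K[x_{i,j}: i\in[c],\ j\in[m]]$ and $\varepsilon^*=\mathbf{P}(\varepsilon)\colon\mathbf{P}_m\to\mathbf{P}_n$, $\varepsilon^*(x_{i,j})=x_{i,\varepsilon(j)}$ for $\varepsilon\in\mathrm{Hom}_{\mathrm{OI}}([m],[n])$ (and similarly for arbitrary totally ordered finite sets). The free module $\mathbf{F}=\mathbf{F}^{\mathrm{OI},d}$ over $\mathbf{P}$ has $\mathbf{F}_m=\bigoplus_{\pi\in\mathrm{Hom}_{\mathrm{OI}}([d],[m])}\mathbf{P}_m e_\pi$ and $\mathbf{F}(\varepsilon)(a e_\pi)=\varepsilon^*(a)e_{\varepsilon\circ\pi}$ for $\varepsilon\in\mathrm{Hom}_{\mathrm{OI}}([m],[n])$. An $\mathrm{OI}$-submodule $\mathbf{M}$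 of $\mathbf{F}$ is a family of $\mathbf{P}_m$-submodules $\mathbf{M}_m\subseteq\mathbf{F}_m$ with $\mathbf{F}(\varepsilon)(\mathbf{M}_m)\subseteq\mathbf{M}_n$ for all $\varepsilon$. An element (subset) of $\mathbf{M}$ means an element (subset) of $\coprod_{m\ge0}\mathbf{M}_m$; $\langle E\rangle_{\mathbf{F}}$ is the smallest $\mathrm{OI}$-submodule of $\mathbf{F}$ containing $E$. A monomial of $\mathbf{F}$ is an element $u e_\pi$ of some $\mathbf{F}_m$, with $u$ a monomial of $\mathbf{P}_m$ and $\pi\in\mathrm{Hom}_{\mathrm{OI}}([d],[m])$. Let $\iota_{m,n}\colon[m]\to[n]$, $j\mapsto j$ ($m\le n$). A monomial order on $\mathbf{F}$ is a total order $>$ on the monomials of $\mathbf{F}$ such that if $\mu,\nu$ are monomials in $\mathbf{F}_m$, then $\mu>\nu$ implies: (1) $u\mu>u\nu>\nu$ for every monomial $u\ne1$ in $\mathbf{P}_m$; (2) $\mathbf{F}(\varepsilon)(\mu)>\mathbf{F}(\varepsilon)(\nu)$ for every $\varepsilon\in\mathrm{Hom}_{\mathrm{OI}}([m],[n])$; (3) $\mathbf{F}(\iota_{m,n})(\mu)>\mu$ whenever $n>m$. For $0\neq q=\sum c_\mu\mu\in\mathbf{F}_m$ (with $c_\mu\in K$, $\mu$ monomials of $\mathbf{F}_m$), the leading monomial $\mathrm{lm}(q)$ is the largest $\mu$ with $c_\mu\neq0$, $\mathrm{lc}(q)$ is its coefficient, and the leading term is $\mathrm{lt}(q)=\mathrm{lc}(q)\,\mathrm{lm}(q)$.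 The initial module of $\mathbf{M}$ is $\mathrm{in}(\mathbf{M})=\langle\mathrm{lt}(q): 0\ne q\in\mathbf{M}\rangle_{\mathbf{F}}$. A subset $B$ of $\mathbf{M}$ is a Gröbner basis of $\mathbf{M}$ if $\mathrm{in}(\mathbf{M})=\langle\mathrm{lt}(b): 0\neq b\in B\rangle_{\mathbf{F}}$. *)

theory Defs
  imports "HOL-Library.Poly_Mapping" "HOL-Library.FuncSet" "HOL-Algebra.Ring_Divisibility"
begin

section \<open>Coefficient rings\<close>

text \<open>
  Coefficient rings have sort \<open>{comm_ring, comm_monoid_mult}\<close>, that is, they are the commutative
  rings with unity. Unlike the class \<open>comm_ring_1\<close>, this does not demand \<open>0 \<noteq> 1\<close>, so the zero
  ring is included.
\<close>

definition ring_of_type :: "'k::{comm_ring,comm_monoid_mult} ring" where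
  "ring_of_type = \<lparr>carrier = UNIV, mult = (*), one = 1, zero = 0, add = (+)\<rparr>"

section \<open>The category OI\<close>

text \<open>
  Morphisms from \<open>[m]\<close> to \<open>[n]\<close> are extensional functions, so that each morphism is represented
  by exactly one function; accordingly they are composed by \<^const>\<open>compose\<close>, which yields an
  extensional function again.
\<close>

definition OI_hom :: "nat \<Rightarrow> nat \<Rightarrow> (nat \<Rightarrow> nat) set" where
  "OI_hom m n = {\<epsilon> \<in> {1..m} \<rightarrow>\<^sub>E {1..n}. mono_on {1..m} \<epsilon> \<and> inj_on \<epsilon> {1..m}}"

definition OI_incl :: "nat \<Rightarrow> (nat \<Rightarrow> nat)" where
  "OI_incl m = restrict (\<lambda>j. j) {1..m}"

section \<open>The OI-algebra P\<close>

text \<open>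
  The variable \<open>x\<^sub>i\<^sub>,\<^sub>j\<close> is the pair \<open>(i, j)\<close>; a monomial is its exponent vector, so the product of
  monomials is \<open>+\<close> and the monomial \<open>1\<close> is \<open>0\<close>.
\<close>

type_synonym pmon = "nat \<times> nat \<Rightarrow>\<^sub>0 nat"
type_synonym 'k ppoly = "pmon \<Rightarrow>\<^sub>0 'k"

definition P_mons :: "nat \<Rightarrow> nat \<Rightarrow> pmon set" where
  "P_mons c m = {u. Poly_Mapping.keys u \<subseteq> {1..c} \<times> {1..m}}"

definition P_alg :: "nat \<Rightarrow> nat \<Rightarrow> 'k::{comm_ring,comm_monoid_mult} ppoly set" where
  "P_alg c m = {p. Poly_Mapping.keys p \<subseteq> P_mons c m}"

definition P_mon_map :: "(nat \<Rightarrow> nat) \<Rightarrow> pmon \<Rightarrow> pmon" where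
  "P_mon_map \<epsilon> u =
    (\<Sum>(i, j)\<in>Poly_Mapping.keys u. Poly_Mapping.single (i, \<epsilon> j) (Poly_Mapping.lookup u (i, j)))"

text \<open>The algebra homomorphism \<open>\<epsilon>\<^sup>*\<close>, written out on the basis of monomials.\<close>

definition P_map :: "(nat \<Rightarrow> nat) \<Rightarrow> 'k::{comm_ring,comm_monoid_mult} ppoly \<Rightarrow> 'k ppoly" where
  "P_map \<epsilon> p =
    (\<Sum>u\<in>Poly_Mapping.keys p. Poly_Mapping.single (P_mon_map \<epsilon> u) (Poly_Mapping.lookup p u))"

section \<open>The free OI-module F\<close>

text \<open>
  An element of the direct sum \<open>\<bigoplus>\<^sub>\<pi> P\<^sub>m e\<^sub>\<pi>\<close> is the map sending \<open>\<pi>\<close> to the coefficient of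
  \<open>e\<^sub>\<pi>\<close>.
\<close>

type_synonym 'k felem = "(nat \<Rightarrow> nat) \<Rightarrow>\<^sub>0 'k ppoly"

definition F_mod :: "nat \<Rightarrow> nat \<Rightarrow> nat \<Rightarrow> 'k::{comm_ring,comm_monoid_mult} felem set" where
  "F_mod c d m = {f. Poly_Mapping.keys f \<subseteq> OI_hom d m \<and> (\<forall>\<pi>. Poly_Mapping.lookup f \<pi> \<in> P_alg c m)}"

definition F_scale ::
  "'k::{comm_ring,comm_monoid_mult} ppoly \<Rightarrow> 'k felem \<Rightarrow> 'k felem" where
  "F_scale p f = Poly_Mapping.map (\<lambda>a. p * a) f"

definition F_map ::
  "nat \<Rightarrow> (nat \<Rightarrow> nat) \<Rightarrow> 'k::{comm_ring,comm_monoid_mult} felem \<Rightarrow> 'k felem" where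
  "F_map d \<epsilon> f =
    (\<Sum>\<pi>\<in>Poly_Mapping.keys f.
      Poly_Mapping.single (compose {1..d} \<epsilon> \<pi>) (P_map \<epsilon> (Poly_Mapping.lookup f \<pi>)))"

definition OI_submodule ::
  "nat \<Rightarrow> nat \<Rightarrow> (nat \<Rightarrow> 'k::{comm_ring,comm_monoid_mult} felem set) \<Rightarrow> bool" where
  "OI_submodule c d M \<longleftrightarrow>
    (\<forall>m. M m \<subseteq> F_mod c d m \<and> 0 \<in> M m \<and>
      (\<forall>f\<in>M m. \<forall>g\<in>M m. f + g \<in> M m) \<and>
      (\<forall>p\<in>P_alg c m. \<forall>f\<in>M m. F_scale p f \<in> M m)) \<and>
    (\<forall>m n. \<forall>\<epsilon>\<in>OI_hom m n. \<forall>f\<in>M m. F_map d \<epsilon> f \<in> M n)"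

text \<open>
  Elements and subsets of \<open>\<Coprod>\<^sub>m M\<^sub>m\<close> are (sets of) pairs of a width \<open>m\<close> and an element of
  \<open>M\<^sub>m\<close>, so the coproduct is \<open>Sigma UNIV M\<close>.
\<close>

definition OI_span ::
  "nat \<Rightarrow> nat \<Rightarrow> (nat \<times> 'k::{comm_ring,comm_monoid_mult} felem) set \<Rightarrow> nat \<Rightarrow> 'k felem set" where
  "OI_span c d E m = \<Inter>{N m |N. OI_submodule c d N \<and> E \<subseteq> Sigma UNIV N}"

section \<open>Monomials and monomial orders\<close>

text \<open>
  The triple \<open>(m, u, \<pi>)\<close> stands for the monomial \<open>u e\<^sub>\<pi>\<close> of \<open>F\<^sub>m\<close>.
\<close>

type_synonym fmon = "nat \<times> pmon \<times> (nat \<Rightarrow> nat)"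

definition F_mons :: "nat \<Rightarrow> nat \<Rightarrow> nat \<Rightarrow> fmon set" where
  "F_mons c d m = {m} \<times> P_mons c m \<times> OI_hom d m"

definition mon_times :: "pmon \<Rightarrow> fmon \<Rightarrow> fmon" where
  "mon_times v \<mu> = (case \<mu> of (m, u, \<pi>) \<Rightarrow> (m, v + u, \<pi>))"

text \<open>The action of \<open>F(\<epsilon>)\<close> on monomials, for \<open>\<epsilon> : [m] \<rightarrow> [n]\<close>; see \<open>F_map_term\<close> below.\<close>

definition F_mon_map :: "nat \<Rightarrow> nat \<Rightarrow> (nat \<Rightarrow> nat) \<Rightarrow> fmon \<Rightarrow> fmon" where
  "F_mon_map d n \<epsilon> \<mu> = (case \<mu> of (m, u, \<pi>) \<Rightarrow> (n, P_mon_map \<epsilon> u, compose {1..d} \<epsilon> \<pi>))"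

definition F_term :: "'k \<Rightarrow> fmon \<Rightarrow> nat \<times> 'k::{comm_ring,comm_monoid_mult} felem" where
  "F_term a \<mu> = (case \<mu> of (m, u, \<pi>) \<Rightarrow>
    (m, Poly_Mapping.single \<pi> (Poly_Mapping.single u a)))"

lemma F_map_term:
  "F_term a (F_mon_map d n \<epsilon> \<mu>) = (n, F_map d \<epsilon> (snd (F_term a \<mu>)))"
proof (cases \<mu>)
  case (fields m u \<pi>)
  show ?thesis
  proof (cases "a = 0")
    case False
    then have "Poly_Mapping.single u a \<noteq> 0"
      by (metis keys_eq_empty keys_single insert_not_empty)
    with False fields show ?thesis
      by (simp add: F_term_def F_mon_map_def F_map_def P_map_def)
  qed (simp add: F_term_def F_mon_map_def F_map_def fields)
qed

text \<open>
  The relation is the strict order \<open>>\<close>. It compares monomials of all widths, and only its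
  restriction to monomials of \<open>F\<close> matters.
\<close>

definition monomial_order :: "nat \<Rightarrow> nat \<Rightarrow> (fmon \<Rightarrow> fmon \<Rightarrow> bool) \<Rightarrow> bool" where
  "monomial_order c d gt \<longleftrightarrow>
    irreflp_on (\<Union>m. F_mons c d m) gt \<and>
    transp_on (\<Union>m. F_mons c d m) gt \<and>
    totalp_on (\<Union>m. F_mons c d m) gt \<and>
    (\<forall>m. \<forall>\<mu>\<in>F_mons c d m. \<forall>\<nu>\<in>F_mons c d m. gt \<mu> \<nu> \<longrightarrow>
      (\<forall>u\<in>P_mons c m. u \<noteq> 0 \<longrightarrow>
        gt (mon_times u \<mu>) (mon_times u \<nu>) \<and> gt (mon_times u \<nu>) \<nu>) \<and>
      (\<forall>n. \<forall>\<epsilon>\<in>OI_hom m n. gt (F_mon_map d n \<epsilon> \<mu>) (F_mon_map d n \<epsilon> \<nu>)) \<and>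
      (\<forall>n>m. gt (F_mon_map d n (OI_incl m) \<mu>) \<mu>))"

section \<open>Leading terms and Groebner bases\<close>

definition F_coeff :: "'k::{comm_ring,comm_monoid_mult} felem \<Rightarrow> fmon \<Rightarrow> 'k" where
  "F_coeff q \<mu> = (case \<mu> of (m, u, \<pi>) \<Rightarrow> Poly_Mapping.lookup (Poly_Mapping.lookup q \<pi>) u)"

definition lm ::
  "(fmon \<Rightarrow> fmon \<Rightarrow> bool) \<Rightarrow> nat \<times> 'k::{comm_ring,comm_monoid_mult} felem \<Rightarrow> fmon" where
  "lm gt = (\<lambda>(m, q). THE \<mu>. fst \<mu> = m \<and> F_coeff q \<mu> \<noteq> 0 \<and>
    (\<forall>\<nu>. fst \<nu> = m \<and> F_coeff q \<nu> \<noteq> 0 \<and> \<nu> \<noteq> \<mu> \<longrightarrow> gt \<mu> \<nu>))"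

definition lc ::
  "(fmon \<Rightarrow> fmon \<Rightarrow> bool) \<Rightarrow> nat \<times> 'k::{comm_ring,comm_monoid_mult} felem \<Rightarrow> 'k" where
  "lc gt q = F_coeff (snd q) (lm gt q)"

definition lt ::
  "(fmon \<Rightarrow> fmon \<Rightarrow> bool) \<Rightarrow> nat \<times> 'k::{comm_ring,comm_monoid_mult} felem \<Rightarrow> nat \<times> 'k felem" where
  "lt gt q = F_term (lc gt q) (lm gt q)"

definition lead_terms ::
  "(fmon \<Rightarrow> fmon \<Rightarrow> bool) \<Rightarrow> (nat \<times> 'k::{comm_ring,comm_monoid_mult} felem) set
    \<Rightarrow> (nat \<times> 'k felem) set" where
  "lead_terms gt E = lt gt ` {q \<in> E. snd q \<noteq> 0}"

definition initial_module ::
  "nat \<Rightarrow> nat \<Rightarrow> (fmon \<Rightarrow> fmon \<Rightarrow> bool) \<Rightarrow> (nat \<Rightarrow> 'k::{comm_ring,comm_monoid_mult} felem set)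
    \<Rightarrow> nat \<Rightarrow> 'k felem set" where
  "initial_module c d gt M = OI_span c d (lead_terms gt (Sigma UNIV M))"

definition groebner_basis ::
  "nat \<Rightarrow> nat \<Rightarrow> (fmon \<Rightarrow> fmon \<Rightarrow> bool) \<Rightarrow> (nat \<Rightarrow> 'k::{comm_ring,comm_monoid_mult} felem set)
    \<Rightarrow> (nat \<times> 'k felem) set \<Rightarrow> bool" where
  "groebner_basis c d gt M B \<longleftrightarrow>
    B \<subseteq> Sigma UNIV M \<and> initial_module c d gt M = OI_span c d (lead_terms gt B)"

end

theory Submission
  imports Defs "HOL-Library.Ramsey" "HOL-Library.Sublist"
begin

text \<open>
  The leading term of a nonzero element is a coefficient times a monomial of \<open>F\<close>, and a Groebner
  basis of \<open>M\<close> is a choice of elements of \<open>M\<close> whose leading terms generate the submodule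
  generated by all of them. So the theorem reduces to \<open>terms_finitely_generated\<close>: every set of
  terms has a finite subset that generates the same submodule. That leading
  terms are terms of \<open>F\<close> at all, rather than unspecified values, is \<open>lm_in_F_mons\<close>.

  Finite generation combines a combinatorial fact about monomials with the chain condition on
  coefficients. Say that \<open>\<mu>\<close> divides \<open>\<nu>\<close> if \<open>\<nu> = v F(\<epsilon>)(\<mu>)\<close> for an OI-morphism
  \<open>\<epsilon>\<close> and a monomial \<open>v\<close>. A monomial \<open>u e\<^sub>\<pi>\<close> of width \<open>m\<close> is a word of length \<open>m\<close>,
  whose letters are the exponents of \<open>u\<close> in one column, together with a mark on the columns in the
  image of \<open>\<pi>\<close>. If one word embeds into another, letter by letter up to increase of exponents, then
  the first monomial divides the second (\<open>fmon_dvd_if_word_emb\<close>). Dickson's lemma for the letters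
  and Higman's lemma for the words show that every sequence of monomials has a subsequence in which
  each monomial divides all later ones.

  Now suppose that a set of terms were not finitely generated. Then it contains a sequence of terms
  \<open>a\<^sub>k \<mu>\<^sub>k\<close>, none of which lies in the submodule generated by the earlier ones, and one may assume
  that each \<open>\<mu>\<^sub>k\<close> divides the later ones. As \<open>K\<close> is noetherian, some \<open>a\<^sub>n\<close> lies in the ideal
  generated by \<open>a\<^sub>0, \<dots>, a\<^sub>n\<^sub>-\<^sub>1\<close>. A submodule that contains the earlier terms contains
  \<open>a\<^sub>k \<mu>\<^sub>n\<close> for \<open>k < n\<close>, because \<open>\<mu>\<^sub>k\<close> divides \<open>\<mu>\<^sub>n\<close>; and the coefficients \<open>a\<close>
  for which it contains \<open>a \<mu>\<^sub>n\<close> form an ideal, so it contains \<open>a\<^sub>n \<mu>\<^sub>n\<close>, a contradiction.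
\<close>

section \<open>Almost full relations\<close>

definition almost_full :: "('a \<Rightarrow> 'a \<Rightarrow> bool) \<Rightarrow> bool" where
  "almost_full R \<longleftrightarrow> (\<forall>f :: nat \<Rightarrow> 'a. \<exists>i j. i < j \<and> R (f i) (f j))"

text \<open>
  Colour the pair \<open>i < j\<close> by whether \<open>R\<close> holds between the corresponding entries. On an infinite
  monochromatic set the colour cannot be the negative one, as its enumeration would give a
  sequence in which \<open>R\<close> holds for no pair.
\<close>

lemma almost_full_increasing_subsequence:
  fixes f :: "nat \<Rightarrow> 'a"
  assumes "almost_full R"
  obtains \<phi> :: "nat \<Rightarrow> nat" where "strict_mono \<phi>" "\<And>i j. i < j \<Longrightarrow> R (f (\<phi> i)) (f (\<phi> j))"
proof -
  define col where "col X = (if R (f (Min X)) (f (Max X)) then 0 else 1 :: nat)" for X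
  have "\<forall>x\<in>UNIV. \<forall>y\<in>UNIV. x \<noteq> y \<longrightarrow> col {x, y} < 2"
    by (simp add: col_def)
  from Ramsey2[OF infinite_UNIV_nat this] obtain Y t
    where Y: "infinite Y" and mono_chrom: "\<forall>x\<in>Y. \<forall>y\<in>Y. x \<noteq> y \<longrightarrow> col {x, y} = t"
    by (elim exE conjE)
  define \<phi> where "\<phi> = enumerate Y"
  have \<phi>: "strict_mono \<phi>" "\<And>i. \<phi> i \<in> Y"
    using Y by (simp_all add: \<phi>_def strict_mono_enumerate enumerate_in_set)
  have pair: "(R (f (\<phi> i)) (f (\<phi> j)) \<longleftrightarrow> t = 0)" if "i < j" for i j
  proof -
    have "\<phi> i < \<phi> j"
      using \<phi>(1) that by (simp add: strict_mono_less)
    then have "Min {\<phi> i, \<phi> j} = \<phi> i" "Max {\<phi> i, \<phi> j} = \<phi> j" "\<phi> i \<noteq> \<phi> j"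
      by auto
    then show ?thesis
      using bspec[OF bspec[OF mono_chrom \<phi>(2)[of i]] \<phi>(2)[of j]] by (auto simp: col_def split: if_splits)
  qed
  obtain i j where "i < j" "R (f (\<phi> i)) (f (\<phi> j))"
    using assms[unfolded almost_full_def, rule_format, of "\<lambda>k. f (\<phi> k)"] by blast
  with pair have "t = 0"
    by blast
  with pair \<phi>(1) that show thesis
    by blast
qed

lemma almost_full_conj:
  assumes "almost_full R" "almost_full S"
  shows "almost_full (\<lambda>x y. R x y \<and> S x y)"
  unfolding almost_full_def
proof
  fix f :: "nat \<Rightarrow> 'a"
  obtain \<phi> :: "nat \<Rightarrow> nat" where \<phi>: "strict_mono \<phi>" "\<And>i j. i < j \<Longrightarrow> R (f (\<phi> i)) (f (\<phi> j))"
    using almost_full_increasing_subsequence[OF assms(1)] by blast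
  obtain i j where "i < j" "S ((f \<circ> \<phi>) i) ((f \<circ> \<phi>) j)"
    using assms(2) unfolding almost_full_def by blast
  with \<phi> show "\<exists>i j. i < j \<and> R (f i) (f j) \<and> S (f i) (f j)"
    by (metis comp_apply strict_mono_less)
qed

lemma almost_full_comap:
  assumes "almost_full R"
  shows "almost_full (\<lambda>x y. R (g x) (g y))"
  using assms unfolding almost_full_def
  by (metis comp_apply)

lemma almost_full_nat: "almost_full ((\<le>) :: nat \<Rightarrow> nat \<Rightarrow> bool)"
  unfolding almost_full_def
proof
  fix f :: "nat \<Rightarrow> nat"
  obtain n where "\<forall>k. f n \<le> f k"
    using ex_has_least_nat[of "\<lambda>_. True" 0 f] by blast
  then show "\<exists>i j. i < j \<and> f i \<le> f j"
    using lessI by blast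
qed

lemma almost_full_implies: "almost_full (\<longrightarrow>)"
  unfolding almost_full_def
proof
  fix f :: "nat \<Rightarrow> bool"
  show "\<exists>i j. i < j \<and> (f i \<longrightarrow> f j)"
    by (cases "f 1") (auto intro: exI[of _ 0] exI[of _ 1] exI[of _ 2])
qed

text \<open>Dickson's lemma, by induction on the number of coordinates.\<close>

lemma almost_full_pointwise:
  assumes "finite I"
  shows "almost_full (\<lambda>v w :: 'i \<Rightarrow> nat. \<forall>i\<in>I. v i \<le> w i)"
  using assms
proof (induction I rule: finite_induct)
  case empty
  then show ?case
    unfolding almost_full_def by auto
next
  case (insert i I)
  have "almost_full (\<lambda>v w :: 'i \<Rightarrow> nat. v i \<le> w i \<and> (\<forall>i\<in>I. v i \<le> w i))"
    by (intro almost_full_conj insert.IH almost_full_comap[OF almost_full_nat, of "\<lambda>v. v i"])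
  then show ?case
    by simp
qed

text \<open>
  Higman's lemma, by the minimal bad sequence argument of Nash-Williams. A bad sequence \<open>m\<close> is
  chosen so that each \<open>m n\<close> is as short as possible, given its predecessors. Along a subsequence
  \<open>\<phi>\<close> the first letters increase; replacing the words from position \<open>\<phi> 0\<close> on by the tails of the
  words \<open>m (\<phi> k)\<close> gives a sequence that is still bad but contradicts the choice of \<open>m (\<phi> 0)\<close>.
\<close>

theorem higman:
  fixes P :: "'a \<Rightarrow> 'a \<Rightarrow> bool"
  assumes "almost_full P"
  shows "almost_full (list_emb P)"
proof (rule ccontr)
  define bad where "bad f \<longleftrightarrow> (\<forall>i j. i < j \<longrightarrow> \<not> list_emb P (f i) (f j))"
    for f :: "nat \<Rightarrow> 'a list"
  define least_at where "least_at n f \<longleftrightarrow> bad f \<and>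
    (\<forall>h. bad h \<and> (\<forall>i<n. h i = f i) \<longrightarrow> length (f n) \<le> length (h n))" for n f
  have minimise: "\<exists>g. least_at n g \<and> (\<forall>i<n. g i = f i)" if bad_f: "bad f" for n f
  proof -
    obtain g where "bad g" "\<forall>i<n. g i = f i"
      and "\<And>h. bad h \<and> (\<forall>i<n. h i = f i) \<Longrightarrow> length (g n) \<le> length (h n)"
      using ex_has_least_nat[of "\<lambda>g. bad g \<and> (\<forall>i<n. g i = f i)" f "\<lambda>g. length (g n)"] bad_f
      by auto
    then show ?thesis
      unfolding least_at_def by (intro exI[of _ g]) simp
  qed
  assume "\<not> almost_full (list_emb P)"
  then obtain f0 where "bad f0"
    unfolding almost_full_def bad_def by blast
  \<comment> \<open>Each \<open>F n\<close> is an entire bad sequence, so that badness is kept at every step; the choices made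
    at positions up to \<open>n\<close> are final, and their diagonal is the minimal bad sequence.\<close>
  have "\<exists>F. \<forall>n. least_at n (F n) \<and> (\<forall>i<Suc n. F (Suc n) i = F n i)"
  proof (rule dependent_nat_choice)
    show "\<exists>g. least_at 0 g"
      using minimise[OF \<open>bad f0\<close>] by blast
    show "\<exists>g. least_at (Suc n) g \<and> (\<forall>i<Suc n. g i = f i)" if "least_at n f" for f n
      using minimise that unfolding least_at_def[of n] by blast
  qed
  then obtain F where F: "\<And>n. least_at n (F n)" "\<And>n i. i \<le> n \<Longrightarrow> F (Suc n) i = F n i"
    by (metis less_Suc_eq_le)
  define m where "m n = F n n" for n
  have F_eq: "F n i = m i" if "i \<le> n" for n i
    using that by (induction n rule: dec_induct) (auto simp: m_def F(2))
  have bad_m: "bad m"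
    unfolding bad_def
  proof (intro allI impI)
    fix i j :: nat
    assume "i < j"
    then show "\<not> list_emb P (m i) (m j)"
      using F(1)[of j] F_eq[of i j] F_eq[of j j] unfolding least_at_def bad_def
      by (metis less_imp_le_nat order_refl)
  qed
  have m_Cons: "m n = hd (m n) # tl (m n)" for n
    using bad_m unfolding bad_def by (metis lessI list.collapse list_emb_Nil)
  obtain \<phi> :: "nat \<Rightarrow> nat" where \<phi>: "strict_mono \<phi>"
    "\<And>i j. i < j \<Longrightarrow> P (hd (m (\<phi> i))) (hd (m (\<phi> j)))"
    using almost_full_increasing_subsequence[OF assms, of "\<lambda>n. hd (m n)"] by blast
  define h where "h k = (if k < \<phi> 0 then m k else tl (m (\<phi> (k - \<phi> 0))))" for k
  have "bad h"
    unfolding bad_def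
  proof (intro allI impI notI)
    fix i j :: nat
    assume "i < j" and emb: "list_emb P (h i) (h j)"
    consider "j < \<phi> 0" | "i < \<phi> 0" "\<phi> 0 \<le> j" | "\<phi> 0 \<le> i"
      using \<open>i < j\<close> by linarith
    then show False
    proof cases
      case 1
      then show False
        using emb bad_m \<open>i < j\<close> by (simp add: h_def bad_def)
    next
      case 2
      then have "list_emb P (m i) (m (\<phi> (j - \<phi> 0)))"
        using emb by (subst m_Cons[of "\<phi> _"]) (auto simp: h_def)
      moreover have "i < \<phi> (j - \<phi> 0)"
        using 2 \<phi>(1) by (metis le0 less_le_trans strict_mono_less_eq)
      ultimately show False
        using bad_m by (simp add: bad_def)
    next
      case 3
      define i' j' where "i' = i - \<phi> 0" and "j' = j - \<phi> 0"
      have "i' < j'"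
        using 3 \<open>i < j\<close> by (simp add: i'_def j'_def)
      moreover have "list_emb P (tl (m (\<phi> i'))) (tl (m (\<phi> j')))"
        using emb 3 \<open>i < j\<close> by (simp add: h_def i'_def j'_def)
      ultimately have "list_emb P (m (\<phi> i')) (m (\<phi> j'))"
        using \<phi>(2) m_Cons by (metis list_emb_Cons2)
      then show False
        using bad_m \<phi>(1) \<open>i' < j'\<close> by (simp add: bad_def strict_mono_less)
    qed
  qed
  moreover have "\<forall>i<\<phi> 0. h i = F (\<phi> 0) i"
    by (simp add: h_def F_eq)
  ultimately have "length (F (\<phi> 0) (\<phi> 0)) \<le> length (h (\<phi> 0))"
    using F(1)[of "\<phi> 0"] unfolding least_at_def by blast
  moreover have "length (h (\<phi> 0)) < length (m (\<phi> 0))"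
    using arg_cong[OF m_Cons, of length "\<phi> 0"] by (simp add: h_def)
  ultimately show False
    by (simp add: m_def)
qed

lemma list_emb_index_map:
  assumes "list_emb P xs ys"
  shows "\<exists>f. \<forall>i<length xs. f i < length ys \<and> P (xs ! i) (ys ! f i) \<and> (\<forall>k<i. f k < f i)"
  using assms
proof (induction rule: list_emb.induct)
  case (list_emb_Nil ys)
  then show ?case
    by simp
next
  case (list_emb_Cons xs ys y)
  then obtain f where
    f: "\<forall>i<length xs. f i < length ys \<and> P (xs ! i) (ys ! f i) \<and> (\<forall>k<i. f k < f i)"
    by blast
  then show ?case
    by (intro exI[of _ "\<lambda>i. Suc (f i)"]) simp
next
  case (list_emb_Cons2 x y xs ys)
  then obtain f where
    f: "\<forall>i<length xs. f i < length ys \<and> P (xs ! i) (ys ! f i) \<and> (\<forall>k<i. f k < f i)"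
    by blast
  have "\<forall>i<length (x # xs). case_nat 0 (\<lambda>k. Suc (f k)) i < length (y # ys) \<and>
      P ((x # xs) ! i) ((y # ys) ! case_nat 0 (\<lambda>k. Suc (f k)) i) \<and>
      (\<forall>k<i. case_nat 0 (\<lambda>k. Suc (f k)) k < case_nat 0 (\<lambda>k. Suc (f k)) i)"
    using f \<open>P x y\<close> by (auto split: nat.split)
  then show ?case
    by blast
qed

section \<open>Divisibility of monomials of F\<close>

definition fmon_dvd :: "nat \<Rightarrow> nat \<Rightarrow> fmon \<Rightarrow> fmon \<Rightarrow> bool" where
  "fmon_dvd c d \<mu> \<nu> \<longleftrightarrow> (\<exists>\<epsilon>\<in>OI_hom (fst \<mu>) (fst \<nu>). \<exists>v\<in>P_mons c (fst \<nu>).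
    \<nu> = mon_times v (F_mon_map d (fst \<nu>) \<epsilon> \<mu>))"

text \<open>
  The letter at list position \<open>k\<close> describes column \<open>k + 1\<close>: its exponents, and whether the column is
  in the image of \<open>\<pi>\<close>. Marking the image suffices to recover \<open>\<pi>\<close>, since \<open>\<pi>\<close> is increasing.
\<close>

definition fmon_word :: "nat \<Rightarrow> fmon \<Rightarrow> ((nat \<Rightarrow> nat) \<times> bool) list" where
  "fmon_word d \<mu> = (case \<mu> of (m, u, \<pi>) \<Rightarrow>
    map (\<lambda>k. (\<lambda>i. Poly_Mapping.lookup u (i, Suc k), Suc k \<in> \<pi> ` {1..d})) [0..<m])"

definition letter_le :: "nat \<Rightarrow> (nat \<Rightarrow> nat) \<times> bool \<Rightarrow> (nat \<Rightarrow> nat) \<times> bool \<Rightarrow> bool" where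
  "letter_le c a b \<longleftrightarrow> (\<forall>i\<in>{1..c}. fst a i \<le> fst b i) \<and> (snd a \<longrightarrow> snd b)"

lemma almost_full_letter_le: "almost_full (letter_le c)"
proof -
  have "almost_full (\<lambda>a b :: (nat \<Rightarrow> nat) \<times> bool.
      (\<forall>i\<in>{1..c}. fst a i \<le> fst b i) \<and> (snd a \<longrightarrow> snd b))"
    by (intro almost_full_conj almost_full_comap[where g = snd, OF almost_full_implies]
        almost_full_comap[where g = fst, OF almost_full_pointwise]) simp
  then show ?thesis
    by (simp add: letter_le_def[abs_def])
qed

lemma OI_hom_less:
  assumes "\<epsilon> \<in> OI_hom m n" "j \<in> {1..m}" "k \<in> {1..m}" "j < k"
  shows "\<epsilon> j < \<epsilon> k"
proof -
  have "\<epsilon> j \<le> \<epsilon> k" "\<epsilon> j \<noteq> \<epsilon> k"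
    using assms mono_onD[of "{1..m}" \<epsilon> j k] inj_onD[of \<epsilon> "{1..m}" j k]
    unfolding OI_hom_def by auto
  then show ?thesis
    by simp
qed

lemma OI_homI:
  assumes "\<epsilon> \<in> {1..m} \<rightarrow>\<^sub>E {1..n}"
    and "\<And>j k. j \<in> {1..m} \<Longrightarrow> k \<in> {1..m} \<Longrightarrow> j < k \<Longrightarrow> \<epsilon> j < \<epsilon> k"
  shows "\<epsilon> \<in> OI_hom m n"
proof -
  have "\<epsilon> j \<le> \<epsilon> k" if "j \<in> {1..m}" "k \<in> {1..m}" "j \<le> k" for j k
    using assms(2)[of j k] that by (cases "j = k") auto
  then have "mono_on {1..m} \<epsilon>"
    by (simp add: monotone_on_def)
  moreover have "inj_on \<epsilon> {1..m}"
  proof (rule inj_onI)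
    fix j k
    assume "j \<in> {1..m}" "k \<in> {1..m}" "\<epsilon> j = \<epsilon> k"
    then show "j = k"
      using assms(2)[of j k] assms(2)[of k j] by (cases j k rule: linorder_cases) auto
  qed
  ultimately show ?thesis
    using assms(1) by (simp add: OI_hom_def)
qed

lemma OI_hom_compose:
  assumes "\<epsilon> \<in> OI_hom m n" "\<pi> \<in> OI_hom d m"
  shows "compose {1..d} \<epsilon> \<pi> \<in> OI_hom d n"
proof (rule OI_homI)
  have \<pi>: "\<pi> j \<in> {1..m}" if "j \<in> {1..d}" for j
    using assms(2) that by (auto simp: OI_hom_def)
  have \<epsilon>: "\<epsilon> j \<in> {1..n}" if "j \<in> {1..m}" for j
    using assms(1) that by (auto simp: OI_hom_def)
  show "compose {1..d} \<epsilon> \<pi> \<in> {1..d} \<rightarrow>\<^sub>E {1..n}"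
    using \<epsilon>[OF \<pi>] by (intro PiE_I) (auto simp: compose_def)
  show "compose {1..d} \<epsilon> \<pi> j < compose {1..d} \<epsilon> \<pi> k"
    if "j \<in> {1..d}" "k \<in> {1..d}" "j < k" for j k
    using OI_hom_less[OF assms(1) \<pi> \<pi>] OI_hom_less[OF assms(2)] that by (simp add: compose_eq)
qed

text \<open>
  Both images have \<open>d\<close> elements, hence coincide, and an increasing map lists its image in order.
\<close>

lemma OI_hom_eqI_image:
  assumes \<pi>: "\<pi> \<in> OI_hom d m" and \<rho>: "\<rho> \<in> OI_hom d m"
    and sub: "\<pi> ` {1..d} \<subseteq> \<rho> ` {1..d}"
  shows "\<pi> = \<rho>"
proof -
  have inj: "inj_on \<pi> {1..d}" "inj_on \<rho> {1..d}"
    and mono: "mono_on {1..d} \<pi>" "mono_on {1..d} \<rho>"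
    using \<pi> \<rho> by (auto simp: OI_hom_def)
  have "\<pi> ` {1..d} = \<rho> ` {1..d}"
    using sub inj by (intro card_subset_eq) (auto simp: card_image)
  then have "map \<pi> [1..<Suc d] = map \<rho> [1..<Suc d]"
    using inj mono
    by (intro sorted_distinct_set_unique)
      (auto simp: distinct_map sorted_map sorted_wrt_iff_nth_less monotone_on_def
        atLeastLessThanSuc_atLeastAtMost simp del: upt_Suc)
  then have "\<forall>j\<in>{1..d}. \<pi> j = \<rho> j"
    by (simp add: map_eq_conv atLeastLessThanSuc_atLeastAtMost del: upt_Suc)
  moreover have "\<pi> \<in> extensional {1..d}" "\<rho> \<in> extensional {1..d}"
    using \<pi> \<rho> by (auto simp: OI_hom_def PiE_def)
  ultimately show ?thesis
    by (intro extensionalityI) auto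
qed

text \<open>
  By injectivity of \<open>\<epsilon>\<close> at most one variable of \<open>u\<close> is sent to a given variable, so exponents are
  moved but never added up.
\<close>

lemma lookup_P_mon_map_le:
  assumes \<epsilon>: "inj_on \<epsilon> {1..m}" and u: "u \<in> P_mons c m"
    and le: "\<And>i j. i \<in> {1..c} \<Longrightarrow> j \<in> {1..m} \<Longrightarrow>
      Poly_Mapping.lookup u (i, j) \<le> Poly_Mapping.lookup w (i, \<epsilon> j)"
  shows "Poly_Mapping.lookup (P_mon_map \<epsilon> u) x \<le> Poly_Mapping.lookup w x"
proof -
  obtain a b where x: "x = (a, b)"
    by (cases x)
  have keys_u: "i \<in> {1..c} \<and> j \<in> {1..m}" if "(i, j) \<in> Poly_Mapping.keys u" for i j
    using u that by (auto simp: P_mons_def)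
  have sum: "Poly_Mapping.lookup (P_mon_map \<epsilon> u) x =
    (\<Sum>(i, j)\<in>Poly_Mapping.keys u. if i = a \<and> \<epsilon> j = b then Poly_Mapping.lookup u (i, j) else 0)"
    unfolding P_mon_map_def lookup_sum
    by (intro sum.cong) (auto simp: lookup_single when_def x)
  show ?thesis
  proof (cases "\<exists>j. (a, j) \<in> Poly_Mapping.keys u \<and> \<epsilon> j = b")
    case True
    then obtain j where j: "(a, j) \<in> Poly_Mapping.keys u" "\<epsilon> j = b"
      by blast
    have "Poly_Mapping.lookup (P_mon_map \<epsilon> u) x =
      (\<Sum>y\<in>Poly_Mapping.keys u. if y = (a, j) then Poly_Mapping.lookup u (a, j) else 0)"
      unfolding sum
    proof (intro sum.cong refl)
      fix y
      assume "y \<in> Poly_Mapping.keys u"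
      then show "(case y of (i, k) \<Rightarrow>
          if i = a \<and> \<epsilon> k = b then Poly_Mapping.lookup u (i, k) else 0) =
          (if y = (a, j) then Poly_Mapping.lookup u (a, j) else 0)"
        using \<epsilon> keys_u j by (cases y) (auto dest: inj_onD)
    qed
    also have "\<dots> = Poly_Mapping.lookup u (a, j)"
      using j by simp
    also have "\<dots> \<le> Poly_Mapping.lookup w x"
      using le keys_u j x by blast
    finally show ?thesis .
  next
    case False
    then have "Poly_Mapping.lookup (P_mon_map \<epsilon> u) x = 0"
      unfolding sum by (intro sum.neutral) auto
    then show ?thesis
      by simp
  qed
qed

text \<open>
  The positions used by the word embedding form the morphism \<open>\<epsilon>\<close>. Exponents do not decrease along it,
  so the quotient \<open>v\<close> of \<open>w\<close> by the image of \<open>u\<close> exists; marked columns go to marked columns, and as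
  both words have exactly \<open>d\<close> marks this forces \<open>\<epsilon> \<circ> \<pi> = \<rho>\<close>.
\<close>

lemma fmon_dvd_if_word_emb:
  assumes \<mu>: "\<mu> \<in> F_mons c d m" and \<nu>: "\<nu> \<in> F_mons c d n"
    and emb: "list_emb (letter_le c) (fmon_word d \<mu>) (fmon_word d \<nu>)"
  shows "fmon_dvd c d \<mu> \<nu>"
proof -
  obtain u \<pi> where \<mu>_eq: "\<mu> = (m, u, \<pi>)" and u: "u \<in> P_mons c m" and \<pi>: "\<pi> \<in> OI_hom d m"
    using \<mu> by (auto simp: F_mons_def)
  obtain w \<rho> where \<nu>_eq: "\<nu> = (n, w, \<rho>)" and w: "w \<in> P_mons c n" and \<rho>: "\<rho> \<in> OI_hom d n"
    using \<nu> by (auto simp: F_mons_def)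
  obtain f where f: "\<forall>i<m. f i < n \<and> letter_le c (fmon_word d \<mu> ! i) (fmon_word d \<nu> ! f i) \<and>
      (\<forall>k<i. f k < f i)"
    using list_emb_index_map[OF emb] by (auto simp: fmon_word_def \<mu>_eq \<nu>_eq)
  define \<epsilon> where "\<epsilon> = (\<lambda>j\<in>{1..m}. Suc (f (j - 1)))"
  have \<epsilon>: "\<epsilon> \<in> OI_hom m n"
  proof (rule OI_homI)
    show "\<epsilon> \<in> {1..m} \<rightarrow>\<^sub>E {1..n}"
      using f by (auto simp: \<epsilon>_def Suc_le_eq)
    show "\<epsilon> j < \<epsilon> k" if "j \<in> {1..m}" "k \<in> {1..m}" "j < k" for j k
      using f that by (auto simp: \<epsilon>_def)
  qed
  have letter: "(\<forall>i\<in>{1..c}. Poly_Mapping.lookup u (i, j) \<le> Poly_Mapping.lookup w (i, \<epsilon> j)) \<and>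
      (j \<in> \<pi> ` {1..d} \<longrightarrow> \<epsilon> j \<in> \<rho> ` {1..d})" if j: "j \<in> {1..m}" for j
  proof -
    obtain k where k: "j = Suc k" "k < m"
      using j by (cases j) auto
    with f have "f k < n" "letter_le c (fmon_word d \<mu> ! k) (fmon_word d \<nu> ! f k)"
      by auto
    with k show ?thesis
      by (simp add: \<epsilon>_def fmon_word_def \<mu>_eq \<nu>_eq letter_le_def)
  qed
  have le: "Poly_Mapping.lookup (P_mon_map \<epsilon> u) x \<le> Poly_Mapping.lookup w x" for x
    using \<epsilon> u letter by (intro lookup_P_mon_map_le) (auto simp: OI_hom_def)
  define v where "v = w - P_mon_map \<epsilon> u"
  have "w = v + P_mon_map \<epsilon> u"
    by (rule poly_mapping_eqI) (simp add: v_def lookup_add lookup_minus le)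
  moreover have "v \<in> P_mons c n"
    using w unfolding P_mons_def v_def
    by (auto simp: in_keys_iff lookup_minus dest!: subsetD)
  moreover have "compose {1..d} \<epsilon> \<pi> = \<rho>"
  proof (rule OI_hom_eqI_image[OF OI_hom_compose[OF \<epsilon> \<pi>] \<rho>])
    have "\<pi> k \<in> {1..m}" if "k \<in> {1..d}" for k
      using \<pi> that by (auto simp: OI_hom_def)
    then show "compose {1..d} \<epsilon> \<pi> ` {1..d} \<subseteq> \<rho> ` {1..d}"
      using letter by (auto simp: compose_eq)
  qed
  ultimately show ?thesis
    using \<epsilon> unfolding fmon_dvd_def \<mu>_eq \<nu>_eq
    by (auto simp: mon_times_def F_mon_map_def)
qed

lemma fmon_dvd_increasing_subsequence:
  assumes "\<And>k. \<mu> k \<in> (\<Union>m. F_mons c d m)"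
  obtains \<phi> :: "nat \<Rightarrow> nat"
  where "strict_mono \<phi>" "\<And>i j. i < j \<Longrightarrow> fmon_dvd c d (\<mu> (\<phi> i)) (\<mu> (\<phi> j))"
proof -
  obtain \<phi> :: "nat \<Rightarrow> nat" where "strict_mono \<phi>"
    "\<And>i j. i < j \<Longrightarrow> list_emb (letter_le c) (fmon_word d (\<mu> (\<phi> i))) (fmon_word d (\<mu> (\<phi> j)))"
    using almost_full_increasing_subsequence[OF higman[OF almost_full_letter_le],
      where f = "\<lambda>k. fmon_word d (\<mu> k)"] by blast
  then show thesis
    using that fmon_dvd_if_word_emb assms by (metis UN_E)
qed

section \<open>Coefficient ideals\<close>

lemma ideal_ring_of_typeI:
  fixes I :: "'k::{comm_ring,comm_monoid_mult} set"
  assumes R: "ring (ring_of_type :: 'k ring)"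
    and "0 \<in> I" "\<And>a b. a \<in> I \<Longrightarrow> b \<in> I \<Longrightarrow> a + b \<in> I" "\<And>a b. a \<in> I \<Longrightarrow> b * a \<in> I"
  shows "ideal I (ring_of_type :: 'k ring)"
proof (rule idealI[OF R])
  interpret R: ring "ring_of_type :: 'k ring"
    by (rule R)
  have neg: "\<ominus>\<^bsub>ring_of_type\<^esub> a = - a" for a :: 'k
    by (rule R.minus_equality) (auto simp: ring_of_type_def)
  have "- a \<in> I" if "a \<in> I" for a
    using assms(4)[OF that, of "- 1"] by simp
  then show "subgroup I (add_monoid (ring_of_type :: 'k ring))"
    using assms neg by (intro R.add.subgroupI) (auto simp: ring_of_type_def a_inv_def)
qed (use assms in \<open>auto simp: ring_of_type_def mult.commute\<close>)

text \<open>The ideals generated by the initial segments of the sequence form a chain, which is stationary.\<close>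

lemma noetherian_sequence_dependent:
  fixes a :: "nat \<Rightarrow> 'a"
  assumes "noetherian_ring R" "\<And>k. a k \<in> carrier R"
  shows "\<exists>n. a n \<in> genideal R (a ` {..<n})"
proof -
  interpret noetherian_ring R
    by (rule assms(1))
  define J where "J n = genideal R (a ` {..<n})" for n
  have sub: "a ` S \<subseteq> carrier R" for S
    using assms(2) by auto
  have J: "ideal (J n) R" for n
    unfolding J_def by (rule genideal_ideal[OF sub])
  have mem: "a k \<in> J n" if "k < n" for k n
    using genideal_self[OF sub, of "{..<n}"] that by (auto simp: J_def)
  have "J m \<subseteq> J n" if "m \<le> n" for m n
    unfolding J_def[of m] using mem that by (intro genideal_minimal[OF J]) auto
  then have "J m \<subseteq> J n \<or> J n \<subseteq> J m" for m n
    by (cases m n rule: le_cases) auto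
  then have "subset.chain {I. ideal I R} (range J)"
    unfolding subset_chain_def using J by auto
  then have "\<Union>(range J) \<in> range J"
    by (intro ideal_chain_is_trivial) auto
  then obtain n where "\<Union>(range J) = J n"
    by blast
  then have "a n \<in> J n"
    using mem[of n "Suc n"] by blast
  then show ?thesis
    unfolding J_def by blast
qed

lemma F_scale_single:
  "F_scale (Poly_Mapping.single v b) (Poly_Mapping.single \<pi> (Poly_Mapping.single u a)) =
    Poly_Mapping.single \<pi> (Poly_Mapping.single (v + u) (b * a))"
  unfolding F_scale_def by (simp add: mult_single)

lemma single_in_P_alg: "v \<in> P_mons c m \<Longrightarrow> Poly_Mapping.single v b \<in> P_alg c m"
  by (auto simp: P_alg_def)

text \<open>
  This is what lets the chain condition in \<open>K\<close> act on terms with a common monomial, without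
  writing any linear combination explicitly.
\<close>

lemma coefficient_set_ideal:
  fixes N :: "nat \<Rightarrow> 'k::{comm_ring,comm_monoid_mult} felem set"
  assumes "ring (ring_of_type :: 'k ring)" and N: "OI_submodule c d N"
  shows "ideal {a. F_term a \<nu> \<in> Sigma UNIV N} (ring_of_type :: 'k ring)"
proof (rule ideal_ring_of_typeI[OF assms(1)])
  obtain n w \<rho> where \<nu>: "\<nu> = (n, w, \<rho>)"
    by (cases \<nu>)
  show "0 \<in> {a. F_term a \<nu> \<in> Sigma UNIV N}"
    using N by (simp add: F_term_def \<nu> OI_submodule_def)
  show "a + b \<in> {a. F_term a \<nu> \<in> Sigma UNIV N}"
    if "a \<in> {a. F_term a \<nu> \<in> Sigma UNIV N}" "b \<in> {a. F_term a \<nu> \<in> Sigma UNIV N}" for a b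
    using N that by (simp add: F_term_def \<nu> OI_submodule_def single_add)
  show "b * a \<in> {a. F_term a \<nu> \<in> Sigma UNIV N}" if "a \<in> {a. F_term a \<nu> \<in> Sigma UNIV N}" for a b
  proof -
    have "Poly_Mapping.single 0 b \<in> P_alg c n"
      by (rule single_in_P_alg) (simp add: P_mons_def)
    moreover have "Poly_Mapping.single \<rho> (Poly_Mapping.single w a) \<in> N n"
      using that by (simp add: F_term_def \<nu>)
    ultimately have "F_scale (Poly_Mapping.single 0 b)
        (Poly_Mapping.single \<rho> (Poly_Mapping.single w a)) \<in> N n"
      using N by (simp add: OI_submodule_def)
    then show ?thesis
      by (simp add: F_scale_single F_term_def \<nu>)
  qed
qed

lemma submodule_closed_fmon_dvd:
  fixes N :: "nat \<Rightarrow> 'k::{comm_ring,comm_monoid_mult} felem set"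
  assumes N: "OI_submodule c d N" and dvd: "fmon_dvd c d \<mu> \<nu>" and a: "F_term a \<mu> \<in> Sigma UNIV N"
  shows "F_term a \<nu> \<in> Sigma UNIV N"
proof -
  obtain m u \<pi> where \<mu>: "\<mu> = (m, u, \<pi>)"
    by (cases \<mu>)
  obtain n \<epsilon> v where \<epsilon>: "\<epsilon> \<in> OI_hom m n" and v: "v \<in> P_mons c n"
    and \<nu>: "\<nu> = mon_times v (F_mon_map d n \<epsilon> \<mu>)"
    using dvd by (auto simp: fmon_dvd_def \<mu>)
  have "F_map d \<epsilon> (snd (F_term a \<mu>)) \<in> N n"
    using N a \<epsilon> by (auto simp: OI_submodule_def \<mu> F_term_def)
  then have "snd (F_term a (F_mon_map d n \<epsilon> \<mu>)) \<in> N n"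
    by (simp add: F_map_term)
  then have "F_scale (Poly_Mapping.single v 1) (snd (F_term a (F_mon_map d n \<epsilon> \<mu>))) \<in> N n"
    using N single_in_P_alg[OF v, of "1 :: 'k"] unfolding OI_submodule_def by blast
  then show ?thesis
    by (simp add: \<mu> \<nu> F_term_def F_mon_map_def mon_times_def F_scale_single)
qed

section \<open>Finite generation of term modules\<close>

lemma terms_finitely_generated:
  fixes T :: "(nat \<times> 'k::{comm_ring,comm_monoid_mult} felem) set"
  assumes noeth: "noetherian_ring (ring_of_type :: 'k ring)"
    and terms: "\<And>t. t \<in> T \<Longrightarrow> \<exists>a. \<exists>\<mu>\<in>(\<Union>m. F_mons c d m). t = F_term a \<mu>"
  shows "\<exists>S\<subseteq>T. finite S \<and> OI_span c d T = OI_span c d S"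
proof -
  have "\<exists>S\<subseteq>T. finite S \<and> (\<forall>N. OI_submodule c d N \<and> S \<subseteq> Sigma UNIV N \<longrightarrow> T \<subseteq> Sigma UNIV N)"
  proof (rule ccontr)
    assume "\<not> ?thesis"
    then have "\<forall>S. \<exists>t N. S \<subseteq> T \<and> finite S \<longrightarrow>
        t \<in> T \<and> OI_submodule c d N \<and> S \<subseteq> Sigma UNIV N \<and> t \<notin> Sigma UNIV N"
      by blast
    then obtain new N where new: "\<And>S. S \<subseteq> T \<Longrightarrow> finite S \<Longrightarrow>
        new S \<in> T \<and> OI_submodule c d (N S) \<and> S \<subseteq> Sigma UNIV (N S) \<and> new S \<notin> Sigma UNIV (N S)"
      by metis
    \<comment> \<open>\<open>S k\<close> collects the first \<open>k\<close> terms; the next one escapes some submodule that contains them.\<close>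
    define S where "S = rec_nat {} (\<lambda>_ S. insert (new S) S)"
    have S: "S 0 = {}" "\<And>k. S (Suc k) = insert (new (S k)) (S k)"
      by (simp_all add: S_def)
    have S_T: "S k \<subseteq> T \<and> finite (S k)" for k
      by (induction k) (use S new in auto)
    have S_mem: "new (S j) \<in> S k" if "j < k" for j k
      using that by (induction k) (auto simp: S less_Suc_eq)
    have "new (S k) \<in> T" for k
      using new[of "S k"] S_T[of k] by blast
    then have "\<forall>k. \<exists>a \<mu>. \<mu> \<in> (\<Union>m. F_mons c d m) \<and> new (S k) = F_term a \<mu>"
      using terms by meson
    then obtain a \<mu> where \<mu>: "\<And>k. \<mu> k \<in> (\<Union>m. F_mons c d m)"
      and eq: "\<And>k. new (S k) = F_term (a k) (\<mu> k)"
      by metis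
    obtain \<phi> :: "nat \<Rightarrow> nat" where \<phi>: "strict_mono \<phi>"
      "\<And>i j. i < j \<Longrightarrow> fmon_dvd c d (\<mu> (\<phi> i)) (\<mu> (\<phi> j))"
      using fmon_dvd_increasing_subsequence[of \<mu> c d] \<mu> by blast
    obtain n where n: "a (\<phi> n) \<in> genideal ring_of_type ((\<lambda>k. a (\<phi> k)) ` {..<n})"
      using noetherian_sequence_dependent[OF noeth, of "\<lambda>k. a (\<phi> k)"]
      by (auto simp: ring_of_type_def)
    define N' where "N' = N (S (\<phi> n))"
    have N': "OI_submodule c d N'" "S (\<phi> n) \<subseteq> Sigma UNIV N'" "new (S (\<phi> n)) \<notin> Sigma UNIV N'"
      using new[of "S (\<phi> n)"] S_T[of "\<phi> n"] unfolding N'_def by auto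
    have R: "ring (ring_of_type :: 'k ring)"
      using noeth by (rule noetherian_ring.axioms)
    let ?I = "{b. F_term b (\<mu> (\<phi> n)) \<in> Sigma UNIV N'}"
    have "(\<lambda>k. a (\<phi> k)) ` {..<n} \<subseteq> ?I"
    proof safe
      fix k
      assume "k < n"
      then have "F_term (a (\<phi> k)) (\<mu> (\<phi> k)) \<in> Sigma UNIV N'"
        using S_mem[of "\<phi> k" "\<phi> n"] \<phi>(1) N'(2) eq by (auto simp: strict_mono_less)
      then show "F_term (a (\<phi> k)) (\<mu> (\<phi> n)) \<in> Sigma UNIV N'"
        by (rule submodule_closed_fmon_dvd[OF N'(1) \<phi>(2)[OF \<open>k < n\<close>]])
    qed
    then have "genideal ring_of_type ((\<lambda>k. a (\<phi> k)) ` {..<n}) \<subseteq> ?I"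
      by (intro ring.genideal_minimal[OF R] coefficient_set_ideal[OF R N'(1)])
    then show False
      using n N'(3) eq by auto
  qed
  then obtain S where S: "S \<subseteq> T" "finite S"
    and sub: "\<And>N. OI_submodule c d N \<Longrightarrow> S \<subseteq> Sigma UNIV N \<Longrightarrow> T \<subseteq> Sigma UNIV N"
    by meson
  have "OI_submodule c d N \<and> T \<subseteq> Sigma UNIV N \<longleftrightarrow> OI_submodule c d N \<and> S \<subseteq> Sigma UNIV N" for N
    using sub[of N] order_trans[OF S(1)] by metis
  then have "OI_span c d T = OI_span c d S"
    by (simp add: OI_span_def fun_eq_iff)
  with S show ?thesis
    by (intro exI[of _ S] conjI)
qed

section \<open>Leading monomials\<close>

text \<open>
  The monomials occurring in \<open>q\<close> form a finite nonempty set, totally ordered by \<open>gt\<close>; hence the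
  description defining \<^const>\<open>lm\<close> has exactly one solution.
\<close>

lemma lm_in_F_mons:
  fixes q :: "'k::{comm_ring,comm_monoid_mult} felem"
  assumes gt: "monomial_order c d gt" and q: "q \<in> F_mod c d m" "q \<noteq> 0"
  shows "lm gt (m, q) \<in> F_mons c d m"
proof -
  define A where "A = {\<mu>. fst \<mu> = m \<and> F_coeff q \<mu> \<noteq> 0}"
  have A_sub: "A \<subseteq> F_mons c d m"
  proof
    fix \<mu>
    assume "\<mu> \<in> A"
    then obtain u \<pi> where \<mu>: "\<mu> = (m, u, \<pi>)"
      and nz: "Poly_Mapping.lookup (Poly_Mapping.lookup q \<pi>) u \<noteq> 0"
      by (cases \<mu>) (auto simp: A_def F_coeff_def)
    then have "Poly_Mapping.lookup q \<pi> \<noteq> 0"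
      by auto
    with nz q(1) have "\<pi> \<in> OI_hom d m" "u \<in> P_mons c m"
      unfolding F_mod_def P_alg_def by (auto simp: in_keys_iff subset_iff)
    then show "\<mu> \<in> F_mons c d m"
      by (simp add: F_mons_def \<mu>)
  qed
  have "A \<subseteq> (\<Union>\<pi>\<in>Poly_Mapping.keys q.
      (\<lambda>u. (m, u, \<pi>)) ` Poly_Mapping.keys (Poly_Mapping.lookup q \<pi>))"
  proof
    fix \<mu>
    assume "\<mu> \<in> A"
    then obtain u \<pi> where \<mu>: "\<mu> = (m, u, \<pi>)"
      and nz: "Poly_Mapping.lookup (Poly_Mapping.lookup q \<pi>) u \<noteq> 0"
      by (cases \<mu>) (auto simp: A_def F_coeff_def)
    then have "\<pi> \<in> Poly_Mapping.keys q"
      by (auto simp: in_keys_iff)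
    with \<mu> nz show "\<mu> \<in> (\<Union>\<pi>\<in>Poly_Mapping.keys q.
        (\<lambda>u. (m, u, \<pi>)) ` Poly_Mapping.keys (Poly_Mapping.lookup q \<pi>))"
      by (auto simp: in_keys_iff image_iff intro!: bexI[of _ \<pi>])
  qed
  then have fin: "finite A"
    by (rule finite_subset) auto
  have "A \<noteq> {}"
  proof -
    obtain \<pi> where "Poly_Mapping.lookup q \<pi> \<noteq> 0"
      using q(2) by (metis lookup_zero poly_mapping_eqI)
    then obtain u where "Poly_Mapping.lookup (Poly_Mapping.lookup q \<pi>) u \<noteq> 0"
      by (metis lookup_zero poly_mapping_eqI)
    then have "(m, u, \<pi>) \<in> A"
      by (simp add: A_def F_coeff_def)
    then show ?thesis
      by blast
  qed
  have A_Un: "A \<subseteq> (\<Union>m. F_mons c d m)"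
    using A_sub by blast
  have trans: "transp_on A gt" and total: "totalp_on A gt" and irrefl: "irreflp_on A gt"
    using gt A_Un unfolding monomial_order_def
    by (blast intro: transp_on_subset totalp_on_subset irreflp_on_subset)+
  obtain \<mu> where \<mu>: "\<mu> \<in> A" "\<forall>\<nu>\<in>A. \<nu> \<noteq> \<mu> \<longrightarrow> gt \<mu> \<nu>"
    using Finite_Set.bex_least_element[OF fin \<open>A \<noteq> {}\<close> trans total] by blast
  have "lm gt (m, q) = (THE \<mu>. \<mu> \<in> A \<and> (\<forall>\<nu>\<in>A. \<nu> \<noteq> \<mu> \<longrightarrow> gt \<mu> \<nu>))"
    by (auto simp: lm_def A_def intro!: arg_cong[where f = The])
  also have "\<dots> = \<mu>"
  proof (rule the_equality)
    show "\<mu> \<in> A \<and> (\<forall>\<nu>\<in>A. \<nu> \<noteq> \<mu> \<longrightarrow> gt \<mu> \<nu>)"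
      using \<mu> by blast
    show "\<nu> = \<mu>" if "\<nu> \<in> A \<and> (\<forall>\<kappa>\<in>A. \<kappa> \<noteq> \<nu> \<longrightarrow> gt \<nu> \<kappa>)" for \<nu>
      using that \<mu> trans irrefl by (metis irreflp_onD transp_onD)
  qed
  finally show ?thesis
    using \<mu>(1) A_sub by blast
qed

theorem theorem6p14:
  fixes c d :: nat
    and gt :: "fmon \<Rightarrow> fmon \<Rightarrow> bool"
    and M :: "nat \<Rightarrow> 'k::{comm_ring,comm_monoid_mult} felem set"
  assumes "noetherian_ring (ring_of_type :: 'k ring)"
    and "c \<ge> 1"
    and "monomial_order c d gt"
    and "OI_submodule c d M"
  shows "\<exists>B. finite B \<and> groebner_basis c d gt M B"
proof -
  let ?T = "lead_terms gt (Sigma UNIV M)"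
  have "\<exists>a. \<exists>\<mu>\<in>(\<Union>m. F_mons c d m). t = F_term a \<mu>" if t_lead: "t \<in> ?T" for t
  proof -
    obtain m q where "q \<in> M m" "q \<noteq> 0" and t: "t = lt gt (m, q)"
      using t_lead by (auto simp: lead_terms_def)
    then have "lm gt (m, q) \<in> F_mons c d m"
      using assms(3,4) by (intro lm_in_F_mons) (auto simp: OI_submodule_def)
    then show ?thesis
      unfolding t lt_def by blast
  qed
  from terms_finitely_generated[OF assms(1) this] obtain S
    where S: "S \<subseteq> ?T" "finite S" "OI_span c d ?T = OI_span c d S"
    by blast
  obtain B where B: "B \<subseteq> {q \<in> Sigma UNIV M. snd q \<noteq> 0}" "finite B" "S = lt gt ` B"
    using finite_subset_image[OF S(2) S(1)[unfolded lead_terms_def]] by (elim exE conjE)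
  have "lead_terms gt B = S"
    using B(1,3) unfolding lead_terms_def by blast
  then have "groebner_basis c d gt M B"
    using B(1) S(3) unfolding groebner_basis_def initial_module_def by auto
  with B(2) show ?thesis
    by blast
qed

end
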